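(* Let $n\ge2$ and let $\mathcal{M}=\partial D\subset\mathbb{R}^n$ be the boundary of a bounded domain $D$, strictly starlike with respect to the origin, which satisfies the $\alpha$-tangent condition for some $\alpha\in(0,\pi/2]$. Let $f_{\mathcal{M}}:\overline{\mathbb{R}}^n\to\overline{\mathbb{R}}^n$ be the quasi-inversion in $\mathcal{M}$. Then for all $x,y\in\mathbb{R}^n\setminus\{0\}$ $$\frac{1}{L^4}\frac{|x-y|}{|x||y|}\le|f_{\mathcal{M}}(x)-f_{\mathcal{M}}(y)|\le L^4\frac{|x-y|}{|x||y|},$$ where $$L=\max\left\{\frac{r_{\max}}{2},\frac{1}{2r_{\min}}\right\}\left(\sqrt{\csc^2\alpha-1}+\sqrt{\csc^2\alpha+3}\right),\qquad r_{\max}=\max_{w\in\mathcal{M}}|w|,\quad r_{\min}=\min_{w\in\mathcal{M}}|w|.$$ In particular, if $\mathcal{M}=S^{n-1}$, then this reduces to the equality $$|f_{S^{n-1}}(x)-f_{S^{n-1}}(y)|=\frac{|x-y|}{|x||y|}.$$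
   Context: $\overline{\mathbb{R}}^n=\mathbb{R}^n\cup\{\infty\}$ and $S^{n-1}$ is the unit sphere. A bounded domain $D\subset\mathbb{R}^n$ is strictly starlike with respect to the point $a$ if each ray emanating from $a$ meets $\partial D$ at exactly one point (in particular $a\in D$). Quasi-inversion: for $x\in\mathbb{R}^n\setminus\{0\}$ let $L_x=\{tx:t>0\}$ and $r_x=|w|$, where $w$ is the unique point of $L_x\cap\mathcal{M}$. The quasi-inversion in $\mathcal{M}$ is $f_{\mathcal{M}}(x)=\frac{r_x^2}{|x|^2}x$ for $x\in\mathbb{R}^n\setminus\{0\}$, $f_{\mathcal{M}}(0)=\infty$, $f_{\mathcal{M}}(\infty)=0$. Tangent condition: for $x,z\in\partial D$, $z\ne x$, let $\alpha(z,x)\in[0,\pi/2]$ be the acute angle which the segment $[z,x]$ makes with the ray from $0$ through $x$, i.e. $\cos\alpha(z,x)=\frac{|\langle z-x,x\rangle|}{|z-x||x|}$, and put $\alpha(x)=\liminf_{z\to x,\,z\in\partial D}\alpha(z,x)$. $D$ (and $\partial D$) satisfies the $\alpha$-tangent condition if $\alpha(x)\ge\alpha$ for every $x\in\partial D$. *)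

theory Defs
  imports "HOL-Analysis.Analysis"
begin

definition open_ray :: "'a::real_vector \<Rightarrow> 'a \<Rightarrow> 'a set" where
  "open_ray a u = {a + t *\<^sub>R u | t. t > 0}"

(* Since a lies in the open set D, it is not on the frontier, so it makes no difference whether
   rays include their origin. The condition "a \<in> D" is spelled out because open rays alone would
   also admit a punctured domain such as "ball a 1 - {a}". *)
definition strictly_starlike :: "'a::real_normed_vector set \<Rightarrow> 'a \<Rightarrow> bool" where
  "strictly_starlike D a \<longleftrightarrow>
     open D \<and> connected D \<and> bounded D \<and> a \<in> D \<and>
     (\<forall>u. u \<noteq> 0 \<longrightarrow> (\<exists>!w. w \<in> open_ray a u \<inter> frontier D))"

definition acute_angle :: "'a::real_inner \<Rightarrow> 'a \<Rightarrow> real" where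
  "acute_angle z x = arccos (\<bar>(z - x) \<bullet> x\<bar> / (norm (z - x) * norm x))"

(* The lower limit is taken in ereal because real is not a complete lattice. The filter
   "at x within M" leaves out the point z = x itself. *)
definition tangent_angle :: "'a::real_inner set \<Rightarrow> 'a \<Rightarrow> ereal" where
  "tangent_angle M x = Liminf (at x within M) (\<lambda>z. ereal (acute_angle z x))"

definition tangent_condition :: "'a::real_inner set \<Rightarrow> real \<Rightarrow> bool" where
  "tangent_condition M \<alpha> \<longleftrightarrow> (\<forall>x\<in>M. ereal \<alpha> \<le> tangent_angle M x)"

definition radius_along :: "'a::real_normed_vector set \<Rightarrow> 'a \<Rightarrow> real" where
  "radius_along M x = norm (THE w. w \<in> open_ray 0 x \<inter> M)"

(* The extended space is encoded as in Alexandroff_compactification: None is the point at infinity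
   and Some x the finite point x. *)
definition quasi_inversion ::
  "'a::real_normed_vector set \<Rightarrow> 'a option \<Rightarrow> 'a option" where
  "quasi_inversion M p =
     (case p of
        None \<Rightarrow> Some 0
      | Some x \<Rightarrow>
          if x = 0 then None
          else Some (((radius_along M x)\<^sup>2 / (norm x)\<^sup>2) *\<^sub>R x))"

(* M is infinite in the intended use, so Max and Min do not apply; Greatest and Least denote the
   attained extrema. *)
definition r_max :: "'a::real_normed_vector set \<Rightarrow> real" where
  "r_max M = (GREATEST r. r \<in> norm ` M)"

definition r_min :: "'a::real_normed_vector set \<Rightarrow> real" where
  "r_min M = (LEAST r. r \<in> norm ` M)"

definition csc :: "real \<Rightarrow> real" where
  "csc t = 1 / sin t"

definition lip_const :: "'a::real_normed_vector set \<Rightarrow> real \<Rightarrow> real" where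
  "lip_const M \<alpha> =
     max (r_max M / 2) (1 / (2 * r_min M)) * (sqrt ((csc \<alpha>)\<^sup>2 - 1) + sqrt ((csc \<alpha>)\<^sup>2 + 3))"

end

theory Submission
  imports Defs
begin

text \<open>
  Write \<open>r\<close> for the radius of the boundary \<open>M\<close>, extended to nonzero vectors as a function that is
  constant along rays, and put \<open>g x = r x *\<^sub>R x\<close>, \<open>h x = (1 / r x) *\<^sub>R x\<close> and
  \<open>i x = (1 / (norm x)\<^sup>2) *\<^sub>R x\<close>. Away from the origin \<open>g\<close> and \<open>h\<close> are inverse to each other
  and the quasi-inversion is \<open>F = g \<circ> i \<circ> h\<close>. Since \<open>i\<close> satisfies
  \<open>norm (i x - i y) = norm (x - y) / (norm x * norm y)\<close>, it suffices that \<open>g\<close> and \<open>h\<close> are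
  \<open>L\<close>-Lipschitz and that \<open>1 / L \<le> r \<le> L\<close>: each of the two Lipschitz maps and each of the two
  values of \<open>r\<close> in \<open>norm (h x) * norm (h y)\<close> costs one factor \<open>L\<close>. The lower bound follows in
  the same way from \<open>h \<circ> F = i \<circ> h\<close> and \<open>g \<circ> h = id\<close>.

  The Lipschitz bound is infinitesimal. Were \<open>r\<close> differentiable, the derivative of \<open>g\<close> at \<open>x\<close>
  would be \<open>r x\<close> times a shear of the plane spanned by \<open>x\<close> and the gradient of \<open>ln r\<close>, with
  shear parameter at most \<open>c = cot \<alpha>\<close> by the tangent condition, and the operator norm of such a
  shear is \<open>(c + sqrt (c\<^sup>2 + 4)) / 2\<close>. Replacing \<open>r\<close> by \<open>1 / r\<close>, hence \<open>g\<close> by \<open>h\<close>, only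
  changes the sign of the gradient. As \<open>csc\<^sup>2 \<alpha> - 1 = cot\<^sup>2 \<alpha>\<close>, this gives exactly the constant \<open>L\<close>.

  Differentiability is not needed. The property \<open>log_slope_le\<close> is a pointwise bound on the slope
  of \<open>ln r\<close>; it follows from the tangent condition (\<open>log_slope_radius_along\<close>) because the radius is
  continuous (\<open>radius_along_tendsto\<close>), and it passes to \<open>1 / r\<close> (\<open>log_slope_le_inverse\<close>). It yields
  the pointwise Lipschitz estimate \<open>radial_stretch_local_bound\<close> for the stretch, and a bound of this
  kind at every point integrates along segments (\<open>lipschitz_from_pointwise_bound\<close>).
\<close>

section \<open>Lipschitz bounds for radial stretches\<close>

text \<open>
  The statement for a segment is additive under subdivision, and it holds for all short
  subintervals around a given parameter by the triangle inequality at that parameter, so bisection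
  gives it for the whole segment.
\<close>

lemma lipschitz_from_pointwise_bound:
  fixes f :: "'a::real_normed_vector \<Rightarrow> 'b::real_normed_vector"
  assumes loc: "\<And>x. \<forall>\<^sub>F y in nhds x. norm (f y - f x) \<le> C * norm (y - x)"
  shows "norm (f p - f q) \<le> C * norm (p - q)"
proof -
  define l where "l t = q + t *\<^sub>R (p - q)" for t
  have l_diff: "l s - l t = (s - t) *\<^sub>R (p - q)" for s t
    by (simp add: l_def algebra_simps)
  have "norm (f (l 1) - f (l 0)) \<le> C * norm (p - q) * (1 - 0)"
  proof (rule Bolzano[where P = "\<lambda>s t. norm (f (l t) - f (l s)) \<le> C * norm (p - q) * (t - s)"])
    show "(0::real) \<le> 1" by simp
  next
    fix a b c :: real
    assume "norm (f (l b) - f (l a)) \<le> C * norm (p - q) * (b - a)"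
      and "norm (f (l c) - f (l b)) \<le> C * norm (p - q) * (c - b)"
    then show "norm (f (l c) - f (l a)) \<le> C * norm (p - q) * (c - a)"
      using norm_triangle_ineq[of "f (l c) - f (l b)" "f (l b) - f (l a)"]
      by (simp add: algebra_simps)
  next
    fix x :: real
    have "isCont l x" unfolding l_def by (intro continuous_intros)
    then have "filterlim l (nhds (l x)) (nhds x)"
      by (simp add: continuous_at tendsto_at_iff_tendsto_nhds)
    from eventually_compose_filterlim[OF loc[of "l x"] this]
    obtain d where d: "d > 0" "\<And>t. dist t x < d \<Longrightarrow> norm (f (l t) - f (l x)) \<le> C * norm (l t - l x)"
      by (auto simp: eventually_nhds_metric)
    have "norm (f (l b) - f (l a)) \<le> C * norm (p - q) * (b - a)"
      if "a \<le> x" "x \<le> b" "b - a < d" for a b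
    proof -
      have "norm (f (l b) - f (l x)) \<le> C * norm (p - q) * (b - x)"
        "norm (f (l a) - f (l x)) \<le> C * norm (p - q) * (x - a)"
        using that d(2)[of a] d(2)[of b] by (auto simp: l_diff dist_real_def mult_ac)
      then show ?thesis
        using norm_triangle_ineq4[of "f (l b) - f (l x)" "f (l a) - f (l x)"]
        by (simp add: algebra_simps)
    qed
    with d(1) show "\<exists>d>0. \<forall>a b. a \<le> x \<and> x \<le> b \<and> b - a < d \<longrightarrow>
        norm (f (l b) - f (l a)) \<le> C * norm (p - q) * (b - a)"
      by blast
  qed
  then show ?thesis by (simp add: l_def)
qed

text \<open>
  The operator norm of the shear with matrix rows \<open>(1, c)\<close> and \<open>(0, 1)\<close>, for \<open>c \<ge> 0\<close>.
\<close>

definition shear_norm :: "real \<Rightarrow> real" where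
  "shear_norm c = (c + sqrt (c\<^sup>2 + 4)) / 2"

lemma shear_norm_ge_1: "c \<ge> 0 \<Longrightarrow> shear_norm c \<ge> 1"
proof -
  assume "c \<ge> 0"
  have "sqrt (c\<^sup>2 + 4) \<ge> 2" by (rule real_le_rsqrt) simp
  with \<open>c \<ge> 0\<close> show ?thesis by (simp add: shear_norm_def)
qed

lemma shear_estimate:
  fixes A B c :: real
  assumes "c \<ge> 0"
  shows "(A + c * B)\<^sup>2 + B\<^sup>2 \<le> (shear_norm c)\<^sup>2 * (A\<^sup>2 + B\<^sup>2)"
proof -
  define K where "K = shear_norm c"
  have K1: "K \<ge> 1" using shear_norm_ge_1[OF assms] by (simp add: K_def)
  have "2 * K - c = sqrt (c\<^sup>2 + 4)"
    by (simp add: K_def shear_norm_def field_simps)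
  then have "(2 * K - c)\<^sup>2 = c\<^sup>2 + 4" by simp
  then have K2: "K\<^sup>2 = c * K + 1"
    by (simp add: power2_eq_square algebra_simps)
  \<comment> \<open>The difference of the two sides is \<open>c * (K * A - B)\<^sup>2 / K\<close>, because \<open>K\<^sup>2 = c * K + 1\<close>.\<close>
  have "K * (K\<^sup>2 * (A\<^sup>2 + B\<^sup>2) - ((A + c * B)\<^sup>2 + B\<^sup>2))
      = K * (K\<^sup>2 * (A\<^sup>2 + B\<^sup>2)) - K * A\<^sup>2 - 2 * c * K * A * B - c * (c * K + 1) * B\<^sup>2 + c * B\<^sup>2 - K * B\<^sup>2"
    by (simp add: power2_eq_square algebra_simps)
  also have "\<dots> = c * (K * A - B)\<^sup>2"
    unfolding K2[symmetric] using K2 by algebra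
  also have "\<dots> \<ge> 0" using assms by simp
  finally have "K\<^sup>2 * (A\<^sup>2 + B\<^sup>2) - ((A + c * B)\<^sup>2 + B\<^sup>2) \<ge> 0"
    using K1 by (simp add: zero_le_mult_iff)
  then show ?thesis by (simp add: K_def)
qed

text \<open>
  A function \<open>\<rho>\<close>, positive away from the origin, has logarithmic slope at most \<open>c\<close> if, at every
  point \<open>q\<close> other than the origin, its relative change is asymptotically at most \<open>c\<close> times the
  relative displacement. The bound is required for every \<open>c' > c\<close>, which encodes an upper limit as
  \<open>p\<close> tends to \<open>q\<close>; the filter \<open>nhds q\<close> includes \<open>p = q\<close>, where it is trivial.
\<close>

definition log_slope_le :: "('a::real_normed_vector \<Rightarrow> real) \<Rightarrow> real \<Rightarrow> bool" where
  "log_slope_le \<rho> c \<longleftrightarrow>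
     (\<forall>q. q \<noteq> 0 \<longrightarrow> (\<forall>c'>c. \<forall>\<^sub>F p in nhds q. \<bar>\<rho> p / \<rho> q - 1\<bar> \<le> c' * (norm (p - q) / norm q)))"

lemma log_slope_le_imp_tendsto_1:
  assumes "log_slope_le \<rho> c" "q \<noteq> 0"
  shows "((\<lambda>p. \<rho> p / \<rho> q) \<longlongrightarrow> 1) (nhds q)"
proof -
  have ev: "\<forall>\<^sub>F p in nhds q. \<bar>\<rho> p / \<rho> q - 1\<bar> \<le> (c + 1) * (norm (p - q) / norm q)"
    using assms by (simp add: log_slope_le_def)
  have "((\<lambda>p. (c + 1) * (norm (p - q) / norm q)) \<longlongrightarrow> (c + 1) * (norm (q - q) / norm q)) (nhds q)"
    using assms by (intro tendsto_intros filterlim_ident) auto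
  then have "((\<lambda>p. (c + 1) * (norm (p - q) / norm q)) \<longlongrightarrow> 0) (nhds q)" by simp
  then have "((\<lambda>p. \<rho> p / \<rho> q - 1) \<longlongrightarrow> 0) (nhds q)"
    by (rule Lim_null_comparison[rotated]) (use ev in simp)
  then show ?thesis by (simp add: LIM_zero_iff)
qed

lemma log_slope_le_inverse:
  fixes \<rho> :: "'a::real_normed_vector \<Rightarrow> real"
  assumes slope: "log_slope_le \<rho> c" and c: "c \<ge> 0" and pos: "\<And>x. x \<noteq> 0 \<Longrightarrow> \<rho> x > 0"
  shows "log_slope_le (\<lambda>x. 1 / \<rho> x) c"
  unfolding log_slope_le_def
proof (intro allI impI)
  fix q :: 'a and c' :: real
  assume q: "q \<noteq> 0" and c': "c' > c"
  define e where "e = (c + c') / 2"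
  have e: "c < e" "e < c'" "e > 0" using c c' by (auto simp: e_def)
  have "((\<lambda>p. e / (\<rho> p / \<rho> q)) \<longlongrightarrow> e / 1) (nhds q)"
    by (intro tendsto_intros log_slope_le_imp_tendsto_1[OF slope q]) auto
  then have "\<forall>\<^sub>F p in nhds q. e / (\<rho> p / \<rho> q) < c'"
    using e by (auto dest: order_tendstoD(2)[where a = c'])
  moreover have "\<forall>\<^sub>F p in nhds q. \<bar>\<rho> p / \<rho> q - 1\<bar> \<le> e * (norm (p - q) / norm q)"
    using slope q e by (simp add: log_slope_le_def)
  moreover have "\<forall>\<^sub>F p in nhds q. p \<noteq> 0"
    using q by (rule t1_space_nhds)
  ultimately show "\<forall>\<^sub>F p in nhds q. \<bar>1 / \<rho> p / (1 / \<rho> q) - 1\<bar> \<le> c' * (norm (p - q) / norm q)"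
  proof eventually_elim
    case (elim p)
    define E where "E = \<rho> p / \<rho> q"
    have E: "E > 0" using pos[OF q] pos[OF elim(3)] by (simp add: E_def)
    have "1 / \<rho> p / (1 / \<rho> q) - 1 = (1 - E) / E"
      using pos[OF q] pos[OF elim(3)] by (simp add: E_def field_simps)
    then have "\<bar>1 / \<rho> p / (1 / \<rho> q) - 1\<bar> = \<bar>E - 1\<bar> / E" using E by simp
    also have "\<dots> \<le> e * (norm (p - q) / norm q) / E"
      using elim(2) E by (intro divide_right_mono) (auto simp: E_def)
    also have "\<dots> = e / E * (norm (p - q) / norm q)" by simp
    also have "\<dots> \<le> c' * (norm (p - q) / norm q)"
      using elim(1) by (intro mult_right_mono) (auto simp: E_def)
    finally show ?case .
  qed
qed

text \<open>
  With \<open>u\<close> the direction of \<open>q\<close>, split \<open>p\<close> into \<open>a *\<^sub>R u\<close> and an orthogonal part \<open>b\<close>. As \<open>\<rho>\<close> is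
  constant along rays, \<open>p\<close> may be moved along its ray into the hyperplane through \<open>q\<close> orthogonal to
  \<open>u\<close>, so that the change of \<open>\<rho>\<close> is controlled by \<open>b\<close> alone. This is what makes
  \<open>shear_estimate\<close> applicable.
\<close>

lemma radial_stretch_local_bound:
  fixes \<rho> :: "'a::real_inner \<Rightarrow> real"
  assumes slope: "log_slope_le \<rho> c" and c: "c \<ge> 0"
    and pos: "\<And>x. x \<noteq> 0 \<Longrightarrow> \<rho> x > 0"
    and hom: "\<And>t x. t > 0 \<Longrightarrow> \<rho> (t *\<^sub>R x) = \<rho> x"
    and bound: "\<And>x. x \<noteq> 0 \<Longrightarrow> \<rho> x \<le> R"
    and q: "q \<noteq> 0" and \<eta>: "\<eta> > 0"
  shows "\<forall>\<^sub>F p in nhds q. norm (\<rho> p *\<^sub>R p - \<rho> q *\<^sub>R q)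
           \<le> R * ((1 + \<eta>) * shear_norm (c + \<eta>)) * norm (p - q)"
proof -
  define u where "u = sgn q"
  define s where "s = norm q"
  have s: "s > 0" using q by (simp add: s_def)
  have u: "norm u = 1" "q = s *\<^sub>R u" using q by (auto simp: u_def s_def norm_sgn sgn_div_norm)
  have uu: "u \<bullet> u = 1" using u(1) by (simp add: dot_square_norm)
  have qu: "q \<bullet> u = s" using u uu by simp
  \<comment> \<open>The point where the ray through \<open>p\<close> meets the hyperplane through \<open>q\<close> orthogonal to \<open>u\<close>.\<close>
  define p' where "p' p = (s / (p \<bullet> u)) *\<^sub>R p" for p
  have "(p' \<longlongrightarrow> (s / (q \<bullet> u)) *\<^sub>R q) (nhds q)"
    unfolding p'_def using qu s by (intro tendsto_intros filterlim_ident) auto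
  then have p'_lim: "(p' \<longlongrightarrow> q) (nhds q)" using qu s by simp
  have ev1: "\<forall>\<^sub>F p in nhds q. \<bar>\<rho> (p' p) / \<rho> q - 1\<bar> \<le> (c + \<eta>) * (norm (p' p - q) / norm q)"
    by (rule eventually_compose_filterlim[OF _ p'_lim])
       (use slope q \<eta> in \<open>simp add: log_slope_le_def\<close>)
  have ev2: "\<forall>\<^sub>F p in nhds q. \<rho> p / \<rho> q < 1 + \<eta>"
    using order_tendstoD(2)[OF log_slope_le_imp_tendsto_1[OF slope q], of "1 + \<eta>"] \<eta> by simp
  have "((\<lambda>p. p \<bullet> u) \<longlongrightarrow> q \<bullet> u) (nhds q)"
    by (intro tendsto_intros filterlim_ident)
  then have ev3: "\<forall>\<^sub>F p in nhds q. p \<bullet> u > 0"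
    using order_tendstoD(1)[of "\<lambda>p. p \<bullet> u" "q \<bullet> u" "nhds q" 0] qu s by auto
  from ev1 ev2 ev3 show ?thesis
  proof eventually_elim
    case (elim p)
    define a where "a = p \<bullet> u"
    define b where "b = p - a *\<^sub>R u"
    define E where "E = \<rho> p / \<rho> q"
    have a: "a > 0" using elim by (simp add: a_def)
    have p0: "p \<noteq> 0" using a by (auto simp: a_def)
    have Epos: "E > 0" using pos[OF q] pos[OF p0] by (simp add: E_def)
    have ub: "u \<bullet> b = 0" by (simp add: b_def a_def inner_diff_right uu inner_commute)
    have pyth: "(norm (x *\<^sub>R u + y *\<^sub>R b))\<^sup>2 = x\<^sup>2 + y\<^sup>2 * (norm b)\<^sup>2" for x y
      by (simp add: power2_norm_eq_inner inner_add_left inner_add_right ub uu inner_commute[of b u])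
         (simp add: power2_eq_square)
    have "p' p - q = (s / a) *\<^sub>R b"
      using a by (simp add: p'_def a_def[symmetric] b_def u(2) scaleR_diff_right)
    then have "norm (p' p - q) / norm q = norm b / a"
      using a s by (simp add: s_def[symmetric])
    moreover have "\<rho> (p' p) = \<rho> p"
      unfolding p'_def using a s by (intro hom) (simp add: a_def)
    ultimately have "\<bar>E - 1\<bar> \<le> (c + \<eta>) * (norm b / a)"
      using elim(1) by (simp add: E_def)
    then have E1: "\<bar>E - 1\<bar> * a \<le> (c + \<eta>) * norm b"
      using a by (simp add: pos_le_divide_eq)
    have pq: "p - q = (a - s) *\<^sub>R u + 1 *\<^sub>R b"
      by (simp add: b_def u(2) algebra_simps)
    have Epq: "E *\<^sub>R p - q = (E * a - s) *\<^sub>R u + E *\<^sub>R b"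
      by (simp add: b_def u(2) algebra_simps)
    have "E * a - s = (a - s) + (E - 1) * a" by (simp add: algebra_simps)
    then have "\<bar>E * a - s\<bar> \<le> \<bar>a - s\<bar> + \<bar>E - 1\<bar> * a"
      using a by (metis abs_mult abs_of_pos abs_triangle_ineq)
    then have radial: "\<bar>E * a - s\<bar> \<le> \<bar>a - s\<bar> + (c + \<eta>) * norm b" using E1 by simp
    have "(norm (E *\<^sub>R p - q))\<^sup>2 = \<bar>E * a - s\<bar>\<^sup>2 + E\<^sup>2 * (norm b)\<^sup>2"
      unfolding Epq pyth by simp
    also have "\<dots> \<le> (\<bar>a - s\<bar> + (c + \<eta>) * norm b)\<^sup>2 + (1 + \<eta>)\<^sup>2 * (norm b)\<^sup>2"
      using radial elim(2) Epos by (intro add_mono mult_right_mono power_mono) (auto simp: E_def)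
    also have "\<dots> \<le> (1 + \<eta>)\<^sup>2 * ((\<bar>a - s\<bar> + (c + \<eta>) * norm b)\<^sup>2 + (norm b)\<^sup>2)"
    proof -
      have "1 \<le> (1 + \<eta>)\<^sup>2" using \<eta> by (intro one_le_power) simp
      then have "1 * (\<bar>a - s\<bar> + (c + \<eta>) * norm b)\<^sup>2 \<le> (1 + \<eta>)\<^sup>2 * (\<bar>a - s\<bar> + (c + \<eta>) * norm b)\<^sup>2"
        by (intro mult_right_mono) auto
      then show ?thesis by (simp add: distrib_left)
    qed
    also have "\<dots> \<le> (1 + \<eta>)\<^sup>2 * ((shear_norm (c + \<eta>))\<^sup>2 * (\<bar>a - s\<bar>\<^sup>2 + (norm b)\<^sup>2))"
      using c \<eta> by (intro mult_left_mono shear_estimate) auto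
    also have "\<bar>a - s\<bar>\<^sup>2 + (norm b)\<^sup>2 = (norm (p - q))\<^sup>2"
      unfolding pq pyth by simp
    also have "(1 + \<eta>)\<^sup>2 * ((shear_norm (c + \<eta>))\<^sup>2 * (norm (p - q))\<^sup>2)
        = ((1 + \<eta>) * shear_norm (c + \<eta>) * norm (p - q))\<^sup>2"
      by (simp add: power_mult_distrib)
    finally have main: "norm (E *\<^sub>R p - q) \<le> (1 + \<eta>) * shear_norm (c + \<eta>) * norm (p - q)"
      using shear_norm_ge_1[of "c + \<eta>"] c \<eta> by (elim power2_le_imp_le) auto
    have "\<rho> p *\<^sub>R p - \<rho> q *\<^sub>R q = \<rho> q *\<^sub>R (E *\<^sub>R p - q)"
      using pos[OF q] by (simp add: E_def scaleR_diff_right)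
    then have "norm (\<rho> p *\<^sub>R p - \<rho> q *\<^sub>R q) = \<rho> q * norm (E *\<^sub>R p - q)"
      using pos[OF q] by simp
    also have "\<dots> \<le> R * ((1 + \<eta>) * shear_norm (c + \<eta>) * norm (p - q))"
      using main bound[OF q] pos[OF q] by (intro mult_mono) auto
    finally show ?case by (simp add: mult_ac)
  qed
qed

text \<open>
  The segment between two points may pass through the origin, where the pointwise bound is
  just \<open>\<rho> y * norm y \<le> R * norm y\<close>.
\<close>

theorem radial_stretch_lipschitz:
  fixes \<rho> :: "'a::real_inner \<Rightarrow> real"
  assumes slope: "log_slope_le \<rho> c" and c: "c \<ge> 0"
    and pos: "\<And>x. x \<noteq> 0 \<Longrightarrow> \<rho> x > 0"
    and hom: "\<And>t x. t > 0 \<Longrightarrow> \<rho> (t *\<^sub>R x) = \<rho> x"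
    and bound: "\<And>x. x \<noteq> 0 \<Longrightarrow> \<rho> x \<le> R"
    and R: "R > 0"
  shows "norm (\<rho> p *\<^sub>R p - \<rho> q *\<^sub>R q) \<le> R * shear_norm c * norm (p - q)"
proof -
  have approx: "norm (\<rho> p *\<^sub>R p - \<rho> q *\<^sub>R q) \<le> R * ((1 + \<eta>) * shear_norm (c + \<eta>)) * norm (p - q)"
    if \<eta>: "\<eta> > 0" for \<eta>
  proof (rule lipschitz_from_pointwise_bound)
    fix x :: 'a
    show "\<forall>\<^sub>F y in nhds x. norm (\<rho> y *\<^sub>R y - \<rho> x *\<^sub>R x)
            \<le> R * ((1 + \<eta>) * shear_norm (c + \<eta>)) * norm (y - x)"
    proof (cases "x = 0")
      case False
      show ?thesis by (rule radial_stretch_local_bound[OF slope c pos hom bound False \<eta>])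
    next
      case True
      have "1 * 1 \<le> (1 + \<eta>) * shear_norm (c + \<eta>)"
        using \<eta> c by (intro mult_mono shear_norm_ge_1) auto
      then have 1: "R * 1 \<le> R * ((1 + \<eta>) * shear_norm (c + \<eta>))"
        using R by (intro mult_left_mono) auto
      have "norm (\<rho> y *\<^sub>R y) \<le> R * ((1 + \<eta>) * shear_norm (c + \<eta>)) * norm y" for y
      proof (cases "y = 0")
        case False
        have "\<rho> y \<le> R * ((1 + \<eta>) * shear_norm (c + \<eta>))"
          using bound[OF False] 1 by linarith
        then show ?thesis using pos[OF False] by (simp add: mult_right_mono)
      qed simp
      then show ?thesis by (simp add: True)
    qed
  qed
  have "((\<lambda>\<eta>. R * ((1 + \<eta>) * shear_norm (c + \<eta>)) * norm (p - q))
      \<longlongrightarrow> R * ((1 + 0) * shear_norm (c + 0)) * norm (p - q)) (at_right 0)"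
    unfolding shear_norm_def by (intro tendsto_intros) auto
  then have "norm (\<rho> p *\<^sub>R p - \<rho> q *\<^sub>R q) \<le> R * ((1 + 0) * shear_norm (c + 0)) * norm (p - q)"
    by (rule tendsto_lowerbound)
       (auto intro: approx eventually_mono[OF eventually_at_right_less])
  then show ?thesis by simp
qed

section \<open>The boundary in polar coordinates\<close>

text \<open>
  The point of \<open>M\<close> on the ray from the origin through \<open>x\<close>, for \<open>x \<noteq> 0\<close>; it is constant along rays.
\<close>

definition ray_point :: "'a::real_normed_vector set \<Rightarrow> 'a \<Rightarrow> 'a" where
  "ray_point M x = (THE w. w \<in> open_ray 0 x \<inter> M)"

lemma radius_along_eq_norm_ray_point: "radius_along M x = norm (ray_point M x)"
  by (simp add: radius_along_def ray_point_def)

lemma norm_scaleR_sgn: "norm x *\<^sub>R sgn x = (x::'a::real_normed_vector)"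
  by (cases "x = 0") (simp_all add: sgn_div_norm)

lemma open_ray_scaleR:
  assumes "t > 0"
  shows "open_ray 0 (t *\<^sub>R x) = open_ray 0 x"
proof -
  have "\<exists>s'. s *\<^sub>R x = s' *\<^sub>R t *\<^sub>R x \<and> s' > 0" if "s > 0" for s
    using that assms by (intro exI[of _ "s / t"]) auto
  moreover have "\<exists>s'. s *\<^sub>R t *\<^sub>R x = s' *\<^sub>R x \<and> s' > 0" if "s > 0" for s
    using that assms by (intro exI[of _ "s * t"]) auto
  ultimately show ?thesis by (fastforce simp: open_ray_def)
qed

lemma radius_along_scaleR: "t > 0 \<Longrightarrow> radius_along M (t *\<^sub>R x) = radius_along M x"
  by (simp add: radius_along_def open_ray_scaleR)

lemma sgn_in_open_ray:
  fixes x :: "'a::real_normed_vector"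
  shows "w \<in> open_ray 0 x \<Longrightarrow> sgn w = sgn x"
  by (auto simp: open_ray_def sgn_scaleR)

text \<open>
  \<open>M\<close> is the boundary of a bounded domain \<open>D\<close> that is strictly starlike with respect to the origin.
\<close>

locale starlike_boundary =
  fixes D M :: "'a::euclidean_space set"
  assumes starlike: "strictly_starlike D 0" and M_eq: "M = frontier D"
begin

lemma compact_M: "compact M"
  using starlike by (simp add: strictly_starlike_def M_eq compact_frontier_bounded)

lemma zero_notin_M: "0 \<notin> M"
proof -
  have "open D" "0 \<in> D" using starlike by (auto simp: strictly_starlike_def)
  then show ?thesis using frontier_disjoint_eq[of D] by (auto simp: M_eq)
qed

lemma ex1_ray_point:
  assumes "x \<noteq> 0"
  shows "\<exists>!w. w \<in> open_ray 0 x \<inter> M"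
proof -
  have "\<forall>u::'a. u \<noteq> 0 \<longrightarrow> (\<exists>!w. w \<in> open_ray 0 u \<inter> M)"
    using starlike unfolding strictly_starlike_def M_eq by (elim conjE)
  from this[rule_format, OF assms] show ?thesis .
qed

lemma ray_point_in: "x \<noteq> 0 \<Longrightarrow> ray_point M x \<in> open_ray 0 x \<inter> M"
  unfolding ray_point_def by (rule theI'[OF ex1_ray_point])

lemma ray_point_unique: "x \<noteq> 0 \<Longrightarrow> w \<in> open_ray 0 x \<Longrightarrow> w \<in> M \<Longrightarrow> ray_point M x = w"
  unfolding ray_point_def by (rule the1_equality[OF ex1_ray_point]) simp_all

lemma radius_along_pos: "x \<noteq> 0 \<Longrightarrow> radius_along M x > 0"
  using ray_point_in[of x] zero_notin_M by (auto simp: radius_along_eq_norm_ray_point)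

lemma ray_point_eq:
  assumes "x \<noteq> 0"
  shows "ray_point M x = (radius_along M x / norm x) *\<^sub>R x"
proof -
  have "ray_point M x = norm (ray_point M x) *\<^sub>R sgn (ray_point M x)"
    by (simp add: norm_scaleR_sgn)
  also have "sgn (ray_point M x) = sgn x"
    using ray_point_in[OF assms] by (auto intro: sgn_in_open_ray)
  finally show ?thesis
    by (simp add: radius_along_eq_norm_ray_point sgn_div_norm divide_inverse)
qed

text \<open>
  Normalisation is a continuous bijection from the compact set \<open>M\<close> onto the unit sphere, so its
  inverse, the restriction of \<open>ray_point M\<close>, is continuous.
\<close>

lemma ray_point_tendsto:
  assumes "q \<noteq> 0"
  shows "(ray_point M \<longlongrightarrow> ray_point M q) (nhds q)"
proof -
  have M0: "w \<noteq> 0" if "w \<in> M" for w using that zero_notin_M by auto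
  have inv: "ray_point M (sgn w) = w" if "w \<in> M" for w
  proof (rule ray_point_unique)
    show "sgn w \<noteq> 0" using M0[OF that] by (simp add: sgn_zero_iff)
    have "w = norm w *\<^sub>R sgn w" by (simp add: norm_scaleR_sgn)
    then show "w \<in> open_ray 0 (sgn w)"
      using M0[OF that] unfolding open_ray_def by (auto intro!: exI[of _ "norm w"])
  qed fact
  have sgn_cont: "continuous_on (- {0::'a}) sgn"
    unfolding sgn_div_norm by (intro continuous_intros) auto
  have "continuous_on (sgn ` M) (ray_point M)"
    by (rule continuous_on_inv[OF continuous_on_subset[OF sgn_cont] compact_M])
       (use M0 inv in auto)
  moreover have "sgn x \<in> sgn ` M" if "x \<noteq> 0" for x
    using ray_point_in[OF that] sgn_in_open_ray[of "ray_point M x" x] by (metis IntD1 IntD2 imageI)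
  ultimately have "continuous_on (- {0}) (\<lambda>x. ray_point M (sgn x))"
    by (intro continuous_on_compose2[OF _ sgn_cont]) auto
  also have "?this \<longleftrightarrow> continuous_on (- {0}) (ray_point M)"
  proof (rule continuous_on_cong[OF refl])
    fix x :: 'a assume "x \<in> - {0}"
    then have "open_ray 0 (sgn x) = open_ray 0 x"
      unfolding sgn_div_norm by (intro open_ray_scaleR) simp
    then show "ray_point M (sgn x) = ray_point M x" by (simp add: ray_point_def)
  qed
  finally have "isCont (ray_point M) q"
    using assms by (simp add: continuous_on_eq_continuous_at open_Compl)
  then show ?thesis by (simp add: continuous_at tendsto_at_iff_tendsto_nhds)
qed

lemma radius_along_tendsto:
  assumes "q \<noteq> 0"
  shows "(radius_along M \<longlongrightarrow> radius_along M q) (nhds q)"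
proof -
  have "radius_along M = (\<lambda>x. norm (ray_point M x))"
    by (rule ext) (rule radius_along_eq_norm_ray_point)
  with tendsto_norm[OF ray_point_tendsto[OF assms]] show ?thesis by simp
qed

lemma M_nonempty: "M \<noteq> {}"
proof -
  obtain b :: 'a where "b \<in> Basis" using nonempty_Basis by blast
  then have "b \<noteq> 0" by (rule nonzero_Basis)
  from ray_point_in[OF this] show ?thesis by auto
qed

lemma radius_along_le_r_max: "x \<noteq> 0 \<Longrightarrow> radius_along M x \<le> r_max M"
proof -
  assume "x \<noteq> 0"
  from continuous_attains_sup[OF compact_M M_nonempty continuous_on_norm_id]
  obtain w where "w \<in> M" "\<forall>v\<in>M. norm v \<le> norm w" by (elim bexE)
  then have w: "w \<in> M" "\<And>v. v \<in> M \<Longrightarrow> norm v \<le> norm w" by simp_all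
  then have "r_max M = norm w"
    unfolding r_max_def by (intro Greatest_equality) auto
  with w(2) ray_point_in[OF \<open>x \<noteq> 0\<close>] show ?thesis
    by (simp add: radius_along_eq_norm_ray_point)
qed

lemma r_min_pos_le_radius_along: "r_min M > 0 \<and> (x \<noteq> 0 \<longrightarrow> r_min M \<le> radius_along M x)"
proof -
  from continuous_attains_inf[OF compact_M M_nonempty continuous_on_norm_id]
  obtain w where "w \<in> M" "\<forall>v\<in>M. norm w \<le> norm v" by (elim bexE)
  then have w: "w \<in> M" "\<And>v. v \<in> M \<Longrightarrow> norm w \<le> norm v" by simp_all
  then have "r_min M = norm w"
    unfolding r_min_def by (intro Least_equality) auto
  moreover have "norm w > 0" using w(1) zero_notin_M by auto
  moreover have "norm w \<le> radius_along M x" if "x \<noteq> 0"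
    using w(2) ray_point_in[OF that] by (simp add: radius_along_eq_norm_ray_point)
  ultimately show ?thesis by simp
qed

end

section \<open>The tangent condition bounds the slope of the radius\<close>

text \<open>
  If the chord from \<open>x\<close> to \<open>z\<close> makes an angle of at least \<open>\<beta>\<close> with the line through \<open>0\<close> and \<open>x\<close>, its
  radial component is at most \<open>cot \<beta>\<close> times the distance \<open>d\<close> of \<open>z\<close> from that line; the norm of \<open>z\<close>
  differs from the length of its projection to the line by at most \<open>d\<^sup>2 / norm z\<close>.
\<close>

lemma angle_bound_imp_norm_diff_le:
  fixes x z :: "'a::real_inner"
  assumes x: "x \<noteq> 0" and z: "z \<noteq> 0" and \<beta>: "0 < \<beta>" "\<beta> \<le> pi / 2"
    and angle: "\<bar>(z - x) \<bullet> x\<bar> \<le> cos \<beta> * (norm (z - x) * norm x)"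
  shows "\<bar>norm z - norm x\<bar>
           \<le> norm (z - (z \<bullet> sgn x) *\<^sub>R sgn x) * (cot \<beta> + norm (z - (z \<bullet> sgn x) *\<^sub>R sgn x) / norm z)"
proof -
  define u where "u = sgn x"
  define a where "a = z \<bullet> u"
  define b where "b = z - a *\<^sub>R u"
  define s where "s = norm x"
  define N where "N = norm z"
  have s: "s > 0" and N: "N > 0" using x z by (auto simp: s_def N_def)
  have "norm u = 1" using x by (simp add: u_def norm_sgn)
  then have uu: "u \<bullet> u = 1" by (simp add: dot_square_norm)
  have xu: "x = s *\<^sub>R u" by (simp add: s_def u_def norm_scaleR_sgn)
  have ub: "u \<bullet> b = 0" by (simp add: b_def a_def inner_diff_right uu inner_commute)
  have pyth: "(norm (t *\<^sub>R u + b))\<^sup>2 = t\<^sup>2 + (norm b)\<^sup>2" for t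
    by (simp add: power2_norm_eq_inner inner_add_left inner_add_right ub uu inner_commute[of b u])
       (simp add: power2_eq_square)
  have zx: "z - x = (a - s) *\<^sub>R u + b" by (simp add: b_def xu algebra_simps)
  have z_eq: "z = a *\<^sub>R u + b" by (simp add: b_def)
  have sin0: "sin \<beta> > 0" using \<beta> by (intro sin_gt_zero) (auto intro: pi_half_less_two order_le_less_trans)
  have cos0: "cos \<beta> \<ge> 0" using \<beta> by (intro cos_ge_zero) auto
  have "(z - x) \<bullet> (s *\<^sub>R u) = (a - s) * s"
    unfolding zx using uu ub by (simp add: inner_add_left inner_commute[of b u])
  then have "(z - x) \<bullet> x = (a - s) * s" by (simp only: xu[symmetric])
  then have "\<bar>a - s\<bar> * s \<le> cos \<beta> * norm (z - x) * s"
    using angle s by (simp add: abs_mult s_def[symmetric] mult_ac)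
  then have "\<bar>a - s\<bar> \<le> cos \<beta> * norm (z - x)" using s by simp
  then have "\<bar>a - s\<bar>\<^sup>2 \<le> (cos \<beta> * norm (z - x))\<^sup>2" by (intro power_mono) auto
  also have "\<dots> = (cos \<beta>)\<^sup>2 * ((a - s)\<^sup>2 + (norm b)\<^sup>2)"
    unfolding power_mult_distrib zx pyth ..
  finally have "(sin \<beta> * \<bar>a - s\<bar>)\<^sup>2 \<le> (cos \<beta> * norm b)\<^sup>2"
    by (simp add: power_mult_distrib sin_squared_eq algebra_simps)
  then have "sin \<beta> * \<bar>a - s\<bar> \<le> cos \<beta> * norm b"
    by (rule power2_le_imp_le) (use cos0 in simp)
  then have radial: "\<bar>a - s\<bar> \<le> cot \<beta> * norm b"
    using sin0 by (simp add: cot_def field_simps)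
  have N2: "N\<^sup>2 = a\<^sup>2 + (norm b)\<^sup>2" unfolding N_def by (subst z_eq) (rule pyth)
  have aN: "\<bar>a\<bar> \<le> N" by (rule power2_le_imp_le) (use N N2 in auto)
  have "(N - \<bar>a\<bar>) * N \<le> (N - \<bar>a\<bar>) * (N + \<bar>a\<bar>)"
    using aN by (intro mult_left_mono) auto
  also have "\<dots> = (norm b)\<^sup>2" using N2 by (simp add: algebra_simps power2_eq_square)
  finally have "N - \<bar>a\<bar> \<le> norm b * (norm b / N)"
    using N by (simp add: field_simps power2_eq_square)
  moreover have "\<bar>N - s\<bar> \<le> (N - \<bar>a\<bar>) + \<bar>a - s\<bar>" using aN s by linarith
  ultimately have "\<bar>N - s\<bar> \<le> norm b * (cot \<beta> + norm b / N)"
    using radial by (simp add: algebra_simps)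
  then show ?thesis by (simp add: N_def s_def b_def a_def u_def)
qed

lemma norm_orthogonal_part_le:
  fixes v u :: "'a::real_inner"
  assumes "norm u = 1"
  shows "norm (v - (v \<bullet> u) *\<^sub>R u) \<le> norm v"
proof (rule power2_le_imp_le)
  have "u \<bullet> u = 1" using assms by (simp add: dot_square_norm)
  then have "(norm (v - (v \<bullet> u) *\<^sub>R u))\<^sup>2 = (norm v)\<^sup>2 - (v \<bullet> u)\<^sup>2"
    unfolding power2_norm_eq_inner
    by (simp add: inner_diff_left inner_diff_right inner_commute power2_eq_square)
  then show "(norm (v - (v \<bullet> u) *\<^sub>R u))\<^sup>2 \<le> (norm v)\<^sup>2" by simp
qed simp

lemma tangent_condition_imp_eventually_angle:
  assumes tc: "tangent_condition M \<alpha>" and "x \<in> M" and \<beta>: "0 < \<beta>" "\<beta> < \<alpha>" "\<beta> \<le> pi / 2"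
  shows "\<forall>\<^sub>F z in nhds x. z \<in> M \<longrightarrow> \<bar>(z - x) \<bullet> x\<bar> \<le> cos \<beta> * (norm (z - x) * norm x)"
proof -
  have "ereal \<alpha> \<le> tangent_angle M x" using tc \<open>x \<in> M\<close> by (simp add: tangent_condition_def)
  moreover have "ereal \<beta> < ereal \<alpha>" using \<beta> by simp
  ultimately have "ereal \<beta> < Liminf (at x within M) (\<lambda>z. ereal (acute_angle z x))"
    unfolding tangent_angle_def by (rule order_less_le_trans[rotated])
  then have "\<forall>\<^sub>F z in at x within M. ereal \<beta> < ereal (acute_angle z x)"
    by (rule less_LiminfD)
  then have "\<forall>\<^sub>F z in nhds x. z \<noteq> x \<longrightarrow> z \<in> M \<longrightarrow> \<beta> < acute_angle z x"
    by (simp add: eventually_at_filter)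
  then show ?thesis
  proof eventually_elim
    case (elim z)
    define n where "n = norm (z - x) * norm x"
    define k where "k = \<bar>(z - x) \<bullet> x\<bar> / n"
    show ?case
    proof (intro impI)
      assume "z \<in> M"
      show "\<bar>(z - x) \<bullet> x\<bar> \<le> cos \<beta> * (norm (z - x) * norm x)"
      proof (cases "n = 0")
        case True
        then show ?thesis by (auto simp: n_def)
      next
        case False
        then have n: "n > 0" by (simp add: n_def)
        have k: "0 \<le> k" "k \<le> 1"
          using n Cauchy_Schwarz_ineq2[of "z - x" x] by (auto simp: k_def n_def[symmetric])
        have "\<beta> < arccos k"
          using elim \<open>z \<in> M\<close> False by (auto simp: acute_angle_def k_def n_def)
        then have "cos (arccos k) < cos \<beta>"
          using \<beta> k by (intro cos_monotone_0_pi arccos_ubound) auto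
        then have "k \<le> cos \<beta>" using k by simp
        then have "\<bar>(z - x) \<bullet> x\<bar> \<le> cos \<beta> * n" using n by (simp add: k_def field_simps)
        then show ?thesis by (simp only: n_def)
      qed
    qed
  qed
qed

text \<open>
  The points of \<open>M\<close> over \<open>p\<close> and \<open>q\<close> form a chord to which \<open>angle_bound_imp_norm_diff_le\<close> applies
  for any angle \<open>\<beta> < \<alpha>\<close>. All error terms vanish as \<open>p\<close> tends to \<open>q\<close>, and \<open>cot \<beta>\<close> tends to \<open>cot \<alpha>\<close>
  as \<open>\<beta>\<close> tends to \<open>\<alpha>\<close>.
\<close>

lemma (in starlike_boundary) log_slope_radius_along:
  assumes tc: "tangent_condition M \<alpha>" and \<alpha>: "0 < \<alpha>" "\<alpha> \<le> pi / 2"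
  shows "log_slope_le (radius_along M) (cot \<alpha>)"
  unfolding log_slope_le_def
proof (intro allI impI)
  fix q :: 'a and c' :: real
  assume q: "q \<noteq> 0" and c': "c' > cot \<alpha>"
  let ?r = "radius_along M"
  have "sin \<alpha> > 0" using \<alpha> by (intro sin_gt_zero) (auto intro: pi_half_less_two order_le_less_trans)
  then have "isCont cot \<alpha>" by (intro isCont_cot) auto
  then have "(cot \<longlongrightarrow> cot \<alpha>) (at_left \<alpha>)"
    by (auto simp: isCont_def intro: tendsto_within_subset[where S = UNIV])
  then have "\<forall>\<^sub>F \<beta> in at_left \<alpha>. cot \<beta> < c'" using c' by (rule order_tendstoD)
  moreover have "\<forall>\<^sub>F \<beta> in at_left \<alpha>. \<beta> \<in> {0<..<\<alpha>}"
    using \<alpha> by (intro eventually_at_left_real)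
  ultimately have "\<forall>\<^sub>F \<beta> in at_left \<alpha>. cot \<beta> < c' \<and> \<beta> \<in> {0<..<\<alpha>}"
    by (rule eventually_conj)
  then obtain \<beta> where \<beta>: "cot \<beta> < c'" "0 < \<beta>" "\<beta> < \<alpha>"
    using eventually_happens'[of "at_left \<alpha>"] by (auto simp: trivial_limit_at_left_real)
  then have \<beta>2: "\<beta> \<le> pi / 2" using \<alpha> by simp
  define x where "x = ray_point M q"
  have xM: "x \<in> M" and x0: "x \<noteq> 0" and sgn_x: "sgn x = sgn q"
    using ray_point_in[OF q] zero_notin_M by (auto simp: x_def intro: sgn_in_open_ray)
  have rq: "?r q > 0" using q by (rule radius_along_pos)
  have ev1: "\<forall>\<^sub>F p in nhds q. ray_point M p \<in> M \<longrightarrow>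
      \<bar>(ray_point M p - x) \<bullet> x\<bar> \<le> cos \<beta> * (norm (ray_point M p - x) * norm x)"
    by (rule eventually_compose_filterlim
          [OF tangent_condition_imp_eventually_angle[OF tc xM \<beta>(2,3) \<beta>2]])
       (use ray_point_tendsto[OF q] in \<open>simp add: x_def\<close>)
  have ev2: "\<forall>\<^sub>F p in nhds q. p \<noteq> 0" using q by (rule t1_space_nhds)
  have "((\<lambda>p. ?r p / ?r q * (norm q / norm p) * (cot \<beta> + norm (p - q) / norm p))
      \<longlongrightarrow> ?r q / ?r q * (norm q / norm q) * (cot \<beta> + norm (q - q) / norm q)) (nhds q)"
    using q rq by (intro tendsto_intros radius_along_tendsto filterlim_ident) auto
  then have ev3: "\<forall>\<^sub>F p in nhds q. ?r p / ?r q * (norm q / norm p) * (cot \<beta> + norm (p - q) / norm p) < c'"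
    by (rule order_tendstoD) (use q rq \<beta> in simp)
  from ev1 ev2 ev3 show "\<forall>\<^sub>F p in nhds q. \<bar>?r p / ?r q - 1\<bar> \<le> c' * (norm (p - q) / norm q)"
  proof eventually_elim
    case (elim p)
    define z where "z = ray_point M p"
    define u where "u = sgn q"
    define d where "d = norm (z - (z \<bullet> u) *\<^sub>R u)"
    have rp: "?r p > 0" using elim(2) by (rule radius_along_pos)
    have zM: "z \<in> M" using ray_point_in[OF elim(2)] by (simp add: z_def)
    have z0: "z \<noteq> 0" using zM zero_notin_M by auto
    have z_eq: "z = (?r p / norm p) *\<^sub>R p" unfolding z_def by (rule ray_point_eq[OF elim(2)])
    have u1: "norm u = 1" using q by (simp add: u_def norm_sgn)
    then have uu: "u \<bullet> u = 1" by (simp add: dot_square_norm)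
    have qu: "q = norm q *\<^sub>R u" by (simp add: u_def norm_scaleR_sgn)
    have orth_eq: "(p - q) - ((p - q) \<bullet> u) *\<^sub>R u = p - (p \<bullet> u) *\<^sub>R u"
      by (subst (1 2) qu) (simp add: inner_diff_left uu algebra_simps)
    have orth: "norm (p - (p \<bullet> u) *\<^sub>R u) \<le> norm (p - q)"
      using norm_orthogonal_part_le[OF u1, of "p - q"] unfolding orth_eq .
    have "z - (z \<bullet> u) *\<^sub>R u = (?r p / norm p) *\<^sub>R (p - (p \<bullet> u) *\<^sub>R u)"
      unfolding z_eq by (simp add: scaleR_diff_right)
    then have "d = ?r p / norm p * norm (p - (p \<bullet> u) *\<^sub>R u)"
      using rp by (simp add: d_def)
    also have "\<dots> \<le> ?r p / norm p * norm (p - q)"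
      using orth rp by (intro mult_left_mono) auto
    finally have d: "d \<le> ?r p / norm p * norm (p - q)" .
    have norms: "norm z = ?r p" "norm x = ?r q"
      by (simp_all add: z_def x_def radius_along_eq_norm_ray_point)
    have cot0: "cot \<beta> \<ge> 0"
      using \<beta> \<beta>2 by (auto simp: cot_def intro!: divide_nonneg_nonneg cos_ge_zero sin_ge_zero)
    have "\<bar>?r p - ?r q\<bar> \<le> d * (cot \<beta> + d / ?r p)"
      using angle_bound_imp_norm_diff_le[OF x0 z0 \<beta>(2) \<beta>2] elim(1) zM
      by (simp add: z_def[symmetric] norms d_def u_def sgn_x)
    also have "\<dots> \<le> (?r p / norm p * norm (p - q)) * (cot \<beta> + (?r p / norm p * norm (p - q)) / ?r p)"
      using d rp cot0 by (intro mult_mono add_mono divide_right_mono) (auto simp: d_def)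
    also have "\<dots> = ?r q * (?r p / ?r q * (norm q / norm p) * (cot \<beta> + norm (p - q) / norm p) * (norm (p - q) / norm q))"
      using rp rq q elim(2) by (simp add: field_simps)
    also have "\<dots> \<le> ?r q * (c' * (norm (p - q) / norm q))"
      using elim(3) rq by (intro mult_left_mono mult_right_mono) auto
    finally have "\<bar>?r p - ?r q\<bar> / ?r q \<le> c' * (norm (p - q) / norm q)"
      using rq by (simp only: pos_divide_le_eq mult.commute)
    moreover have "\<bar>?r p / ?r q - 1\<bar> = \<bar>?r p - ?r q\<bar> / ?r q"
    proof -
      have "?r p / ?r q - 1 = (?r p - ?r q) / ?r q" using rq by (simp add: diff_divide_distrib)
      then show ?thesis using rq by (simp only: abs_divide abs_of_pos)
    qed
    ultimately show ?case by simp
  qed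
qed

section \<open>The quasi-inversion\<close>

text \<open>The inversion in the unit sphere.\<close>

lemma norm_inversion_diff:
  fixes x y :: "'a::real_inner"
  assumes "x \<noteq> 0" "y \<noteq> 0"
  shows "norm ((1 / (norm x)\<^sup>2) *\<^sub>R x - (1 / (norm y)\<^sup>2) *\<^sub>R y) = norm (x - y) / (norm x * norm y)"
proof (rule power2_eq_imp_eq)
  have n: "norm x > 0" "norm y > 0" using assms by auto
  have expand: "(norm (s *\<^sub>R x - t *\<^sub>R y))\<^sup>2 = s\<^sup>2 * (norm x)\<^sup>2 - 2 * s * t * (x \<bullet> y) + t\<^sup>2 * (norm y)\<^sup>2"
    for s t :: real
    by (simp add: power2_norm_eq_inner inner_diff_left inner_diff_right inner_commute[of y x])
       (simp add: power2_eq_square algebra_simps)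
  have "(norm ((1 / (norm x)\<^sup>2) *\<^sub>R x - (1 / (norm y)\<^sup>2) *\<^sub>R y))\<^sup>2
      = ((norm x)\<^sup>2 - 2 * (x \<bullet> y) + (norm y)\<^sup>2) / ((norm x)\<^sup>2 * (norm y)\<^sup>2)"
    unfolding expand using n by (simp add: power2_eq_square field_simps)
  also have "\<dots> = (norm (x - y) / (norm x * norm y))\<^sup>2"
    using expand[of 1 1] by (simp add: power_divide power_mult_distrib)
  finally show "(norm ((1 / (norm x)\<^sup>2) *\<^sub>R x - (1 / (norm y)\<^sup>2) *\<^sub>R y))\<^sup>2
      = (norm (x - y) / (norm x * norm y))\<^sup>2" .
qed auto

lemma lip_const_eq_shear_norm:
  assumes "0 < \<alpha>" "\<alpha> \<le> pi / 2"
  shows "lip_const M \<alpha> = max (r_max M) (1 / r_min M) * shear_norm (cot \<alpha>)"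
proof -
  have sin0: "sin \<alpha> > 0" using assms by (intro sin_gt_zero) (auto intro: pi_half_less_two order_le_less_trans)
  have cot0: "cot \<alpha> \<ge> 0"
    using assms sin0 by (auto simp: cot_def intro!: divide_nonneg_pos cos_ge_zero)
  have "(csc \<alpha>)\<^sup>2 = (cot \<alpha>)\<^sup>2 + 1"
    using sin0 by (simp add: csc_def cot_def power_divide field_simps)
  then have "sqrt ((csc \<alpha>)\<^sup>2 - 1) = cot \<alpha>" "(csc \<alpha>)\<^sup>2 + 3 = (cot \<alpha>)\<^sup>2 + 4"
    using cot0 by auto
  moreover have "max (r_max M / 2) (1 / (2 * r_min M)) = max (r_max M) (1 / r_min M) / 2"
    by (simp add: max_def field_simps)
  ultimately show ?thesis by (simp only: lip_const_def shear_norm_def times_divide_eq_left times_divide_eq_right)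
qed

context starlike_boundary
begin

lemma radial_maps_lipschitz:
  assumes tc: "tangent_condition M \<alpha>" and \<alpha>: "0 < \<alpha>" "\<alpha> \<le> pi / 2"
    and L: "L = lip_const M \<alpha>"
  shows "norm (radius_along M p *\<^sub>R p - radius_along M q *\<^sub>R q) \<le> L * norm (p - q)"
    and "norm ((1 / radius_along M p) *\<^sub>R p - (1 / radius_along M q) *\<^sub>R q) \<le> L * norm (p - q)"
proof -
  have cot0: "cot \<alpha> \<ge> 0"
    using \<alpha> by (auto simp: cot_def intro!: divide_nonneg_nonneg cos_ge_zero sin_ge_zero)
  define m where "m = max (r_max M) (1 / r_min M)"
  have m: "m > 0" "\<And>x. x \<noteq> 0 \<Longrightarrow> radius_along M x \<le> m" "\<And>x. x \<noteq> 0 \<Longrightarrow> 1 / radius_along M x \<le> m"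
  proof -
    show "m > 0" using r_min_pos_le_radius_along[of 0] by (auto simp: m_def less_max_iff_disj)
    fix x :: 'a assume x: "x \<noteq> 0"
    show "radius_along M x \<le> m" using radius_along_le_r_max[OF x] by (simp add: m_def)
    have "1 / radius_along M x \<le> 1 / r_min M"
      using r_min_pos_le_radius_along[of x] x by (auto intro!: divide_left_mono mult_pos_pos)
    then show "1 / radius_along M x \<le> m" by (simp add: m_def)
  qed
  note slope = log_slope_radius_along[OF tc \<alpha>]
  have L_eq: "L = m * shear_norm (cot \<alpha>)"
    using lip_const_eq_shear_norm[OF \<alpha>] by (simp add: L m_def)
  show "norm (radius_along M p *\<^sub>R p - radius_along M q *\<^sub>R q) \<le> L * norm (p - q)"
    unfolding L_eq
    by (rule radial_stretch_lipschitz[OF slope cot0])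
       (simp_all add: radius_along_pos radius_along_scaleR m)
  show "norm ((1 / radius_along M p) *\<^sub>R p - (1 / radius_along M q) *\<^sub>R q) \<le> L * norm (p - q)"
    unfolding L_eq
    by (rule radial_stretch_lipschitz[OF log_slope_le_inverse[OF slope cot0 radius_along_pos] cot0])
       (simp_all add: radius_along_pos radius_along_scaleR m)
qed

lemma radius_along_bounds_lip_const:
  assumes \<alpha>: "0 < \<alpha>" "\<alpha> \<le> pi / 2" and L: "L = lip_const M \<alpha>" and x: "x \<noteq> 0"
  shows "radius_along M x \<le> L" and "1 / L \<le> radius_along M x"
proof -
  have cot0: "cot \<alpha> \<ge> 0"
    using \<alpha> by (auto simp: cot_def intro!: divide_nonneg_nonneg cos_ge_zero sin_ge_zero)
  define m where "m = max (r_max M) (1 / r_min M)"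
  have r0: "r_min M > 0" and r: "r_min M \<le> radius_along M x"
    using r_min_pos_le_radius_along[of x] x by auto
  have m: "m \<ge> r_max M" "m \<ge> 1 / r_min M" by (auto simp: m_def)
  have m0: "m > 0" using m(2) r0 by (meson less_le_trans zero_less_divide_1_iff)
  have "m * 1 \<le> m * shear_norm (cot \<alpha>)"
    using m0 by (intro mult_left_mono shear_norm_ge_1 cot0) simp
  then have Lm: "m \<le> L"
    using lip_const_eq_shear_norm[OF \<alpha>, of M] by (simp add: L m_def)
  show "radius_along M x \<le> L" using radius_along_le_r_max[OF x] m Lm by linarith
  have "1 / L \<le> 1 / m" using Lm m0 by (intro divide_left_mono) auto
  also have "\<dots> \<le> r_min M" using m(2) m0 r0 by (simp add: field_simps)
  finally show "1 / L \<le> radius_along M x" using r by simp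
qed

theorem quasi_inversion_bounds:
  assumes tc: "tangent_condition M \<alpha>" and \<alpha>: "0 < \<alpha>" "\<alpha> \<le> pi / 2"
    and L: "L = lip_const M \<alpha>" and x: "x \<noteq> 0" and y: "y \<noteq> 0"
  defines "F \<equiv> \<lambda>x. ((radius_along M x)\<^sup>2 / (norm x)\<^sup>2) *\<^sub>R x"
  shows "1 / L ^ 4 * (norm (x - y) / (norm x * norm y)) \<le> norm (F x - F y)"
    and "norm (F x - F y) \<le> L ^ 4 * (norm (x - y) / (norm x * norm y))"
proof -
  let ?r = "radius_along M"
  define h where "h v = (1 / ?r v) *\<^sub>R v" for v
  define g where "g v = ?r v *\<^sub>R v" for v
  define i where "i v = (1 / (norm v)\<^sup>2) *\<^sub>R v" for v :: 'a
  have lip: "norm (g p - g q) \<le> L * norm (p - q)" "norm (h p - h q) \<le> L * norm (p - q)" for p q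
    unfolding g_def h_def by (rule radial_maps_lipschitz[OF tc \<alpha> L])+
  have bounds: "0 < ?r v" "?r v \<le> L" "1 / L \<le> ?r v" if "v \<noteq> 0" for v
    using that radius_along_pos radius_along_bounds_lip_const[OF \<alpha> L] by auto
  have L0: "L > 0" using bounds(1,2)[OF x] by linarith
  have gih: "F v = g (i (h v))" and hF: "h (F v) = i (h v)" and gh: "g (h v) = v"
    and h0: "h v \<noteq> 0" and nh: "norm (h v) = norm v / ?r v" if v: "v \<noteq> 0" for v
  proof -
    have r: "?r v > 0" and n: "norm v > 0" using bounds(1)[OF v] v by auto
    show h0: "h v \<noteq> 0" using r v by (simp add: h_def)
    show nh: "norm (h v) = norm v / ?r v" using r by (simp add: h_def)
    have ih: "i (h v) = (?r v / (norm v)\<^sup>2) *\<^sub>R v"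
      unfolding i_def nh unfolding h_def using r by (simp add: power2_eq_square)
    show "g (h v) = v" unfolding g_def h_def using r by (simp add: radius_along_scaleR)
    show "F v = g (i (h v))" unfolding ih g_def F_def using r n
      by (simp add: radius_along_scaleR power2_eq_square)
    show "h (F v) = i (h v)" unfolding ih unfolding h_def F_def using r n
      by (simp add: radius_along_scaleR power2_eq_square)
  qed
  have n: "norm x > 0" "norm y > 0" using x y by auto
  note rx = bounds[OF x] and ry = bounds[OF y]
  have inv: "norm (i (h x) - i (h y)) = norm (h x - h y) * (?r x * ?r y / (norm x * norm y))"
    using norm_inversion_diff[OF h0[OF x] h0[OF y]] by (simp add: i_def nh x y)

  have "norm (F x - F y) \<le> L * norm (i (h x) - i (h y))"
    unfolding gih[OF x] gih[OF y] by (rule lip)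
  also have "\<dots> \<le> L * ((L * norm (x - y)) * (L * L / (norm x * norm y)))"
    unfolding inv using lip(2)[of x y] rx ry L0 n
    by (intro mult_left_mono mult_mono divide_right_mono) auto
  also have "\<dots> = L ^ 4 * (norm (x - y) / (norm x * norm y))"
    by (simp add: power4_eq_xxxx)
  finally show "norm (F x - F y) \<le> L ^ 4 * (norm (x - y) / (norm x * norm y))" .

  have "norm (x - y) \<le> L * norm (h x - h y)"
    using lip(1)[of "h x" "h y"] by (simp add: gh x y)
  then have h_lower: "norm (x - y) / L \<le> norm (h x - h y)"
    using L0 by (simp add: field_simps)
  have "1 / L ^ 4 * (norm (x - y) / (norm x * norm y))
      = (norm (x - y) / L * ((1 / L) * (1 / L) / (norm x * norm y))) / L"
    by (simp add: power4_eq_xxxx)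
  also have "\<dots> \<le> norm (i (h x) - i (h y)) / L"
    unfolding inv using h_lower rx ry L0 n
    by (intro divide_right_mono mult_mono) auto
  also have "\<dots> \<le> norm (F x - F y)"
    using lip(2)[of "F x" "F y"] L0 by (simp add: hF x y field_simps)
  finally show "1 / L ^ 4 * (norm (x - y) / (norm x * norm y)) \<le> norm (F x - F y)" .
qed

lemma radius_along_unit_sphere: "M = sphere 0 1 \<Longrightarrow> x \<noteq> 0 \<Longrightarrow> radius_along M x = 1"
  using ray_point_in[of x] by (auto simp: radius_along_eq_norm_ray_point)

end

theorem theorem5p3:
  fixes D M :: "(real ^ 'n) set" and \<alpha> L :: real
    and f :: "(real ^ 'n) option \<Rightarrow> (real ^ 'n) option"
  assumes "CARD('n) \<ge> 2"
    and "strictly_starlike D 0"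
    and "M = frontier D"
    and "0 < \<alpha>" and "\<alpha> \<le> pi / 2"
    and "tangent_condition M \<alpha>"
    and "f = quasi_inversion M"
    and "L = lip_const M \<alpha>"
  shows "(\<forall>x y. x \<noteq> 0 \<longrightarrow> y \<noteq> 0 \<longrightarrow>
            1 / L ^ 4 * (norm (x - y) / (norm x * norm y))
              \<le> norm (the (f (Some x)) - the (f (Some y)))
          \<and> norm (the (f (Some x)) - the (f (Some y)))
              \<le> L ^ 4 * (norm (x - y) / (norm x * norm y)))
       \<and> (M = sphere 0 1 \<longrightarrow>
            (\<forall>x y. x \<noteq> 0 \<longrightarrow> y \<noteq> 0 \<longrightarrow>
               norm (the (f (Some x)) - the (f (Some y)))
                 = norm (x - y) / (norm x * norm y)))"
proof -
  interpret starlike_boundary D M by unfold_locales fact+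
  have f: "the (f (Some x)) = ((radius_along M x)\<^sup>2 / (norm x)\<^sup>2) *\<^sub>R x" if "x \<noteq> 0" for x
    using that by (simp add: \<open>f = _\<close> quasi_inversion_def)
  show ?thesis
  proof (intro conjI allI impI)
    fix x y :: "real ^ 'n"
    assume xy: "x \<noteq> 0" "y \<noteq> 0"
    note bounds = quasi_inversion_bounds[OF \<open>tangent_condition M \<alpha>\<close> \<open>0 < \<alpha>\<close> \<open>\<alpha> \<le> pi / 2\<close> \<open>L = _\<close> xy]
    show "1 / L ^ 4 * (norm (x - y) / (norm x * norm y)) \<le> norm (the (f (Some x)) - the (f (Some y)))"
      using bounds(1) by (simp only: f xy not_False_eq_True)
    show "norm (the (f (Some x)) - the (f (Some y))) \<le> L ^ 4 * (norm (x - y) / (norm x * norm y))"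
      using bounds(2) by (simp only: f xy not_False_eq_True)
  next
    fix x y :: "real ^ 'n"
    assume M: "M = sphere 0 1" and xy: "x \<noteq> 0" "y \<noteq> 0"
    have "radius_along M x = 1" "radius_along M y = 1"
      using radius_along_unit_sphere[OF M] xy by blast+
    then show "norm (the (f (Some x)) - the (f (Some y))) = norm (x - y) / (norm x * norm y)"
      using norm_inversion_diff[OF xy] by (simp add: f xy)
  qed
qed

end
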